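(* Let $f:\mathbb{R}^n\to\mathbb{R}$ be $m$-strongly convex with $L$-Lipschitz gradient. Run $k\ge1$ steps of the descent method with Approximately Exact Line Search (defined in the context) with parameters $T_0>0$, $\beta\in(0,1)$, with search directions $d_j$ that are descent directions of one of the types listed in the context, and let $\gamma_j=\frac{-d_j^T\nabla f(x_j)}{\|d_j\|^2}\in[\gamma_{\min},\gamma_{\max}]$ with $\gamma_{\min},\gamma_{\max}$ as given in the context for that type. Then the total number of function evaluations used by the line searches in these $k$ steps is at most $$k\left(4+\left\lceil\log_{1/\beta}\left(\frac{\gamma_{\max}\left(1+\sqrt{1-\frac mL}\right)}{\gamma_{\min}\left(1-\sqrt{1-\frac mL}\right)}\right)\right\rceil\right)+\left\lceil\log_{1/\beta}\max\left(\frac{\beta^2\gamma_{\min}\left(1-\sqrt{1-\frac mL}\right)}{mT_0},\ \frac{mT_0}{\beta\gamma_{\max}\left(1+\sqrt{1-\frac mL}\right)}\right)\right\rceil.$$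
   Context: $\|\cdot\|$ is the Euclidean norm. $f$ is $m$-strongly convex ($m>0$): $f(y)\ge f(x)+\nabla f(x)^T(y-x)+\frac m2\|y-x\|^2$ for all $x,y$. $f$ has $L$-Lipschitz gradient: $\|\nabla f(x)-\nabla f(y)\|\le L\|x-y\|$ for all $x,y$. $x_*$ is the minimizer of $f$. $\Delta>0$ is the user-specified tolerance for $\|x-x_*\|$ at termination, and it is a standing assumption that $\|x_j-x_*\|\ge\Delta$ during execution. A descent direction at $x$ is a vector $d$ with $d^T\nabla f(x)<0$. For a unit vector $v$, $f'_v(x)=v^T\nabla f(x)$. Types of search directions and corresponding bounds on $\gamma_j$: (i) $d_j=-\nabla f(x_j)$, or $d_j=-f'_{v_j}(x_j)v_j$ for a unit vector $v_j$: $\gamma_{\min}=\gamma_{\max}=1$. (ii) $d_j=-\nabla f(x_j)+\rho_j$ with $\|\rho_j\|\le\frac{L\sigma\sqrt n}{2}$ (e.g. $-d_j$ the forward finite differencing gradient approximation with radius $\sigma$), where $\sigma=\frac{2\tilde\sigma m\Delta}{L\sqrt n}$, $\tilde\sigma<1$: $\gamma_{\min}=\frac{1-\tilde\sigma}{(1+\tilde\sigma)^2}$, $\gamma_{\max}=\frac1{1-\tilde\sigma}$. (iii) $d_j=(-f'_{v_j}(x_j)+\rho_j)v_j$ for a unit vector $v_j$ with $|\rho_j|\le\frac{L\sigma}{2}$ (e.g. forward finite differencing of the directional derivative with radius $\sigma$), where $\sigma=\frac{2\tilde\sigma m\Delta}{L}$, $\tilde\sigma<1$: $\gamma_{\min}=\frac1{1+\tilde\sigma}$,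 $\gamma_{\max}=\frac1{1-\tilde\sigma}$. Descent method: given $x_0$, $T_0>0$, $\beta\in(0,1)$, set $t_{-1}=T_0$. For $j=0,1,\dots,k-1$: choose a search direction $d_j$; let $t_j$ be the output of $\mathrm{AELS}(f,x_j,T,\beta,d_j)$ with $T=\beta^{-1}t_{j-1}$; set $x_{j+1}=x_j+t_jd_j$. Approximately Exact Line Search $\mathrm{AELS}(f,x,T,\beta,d)$: 1. Set $t\leftarrow T$, $f_{old}\leftarrow f(x)$, $f_{new}\leftarrow f(x+td)$, $\alpha\leftarrow\beta$. If $f_{new}\le f_{old}$, set $\alpha\leftarrow\beta^{-1}$. 2. Repeat $\{t\leftarrow\alpha t;\ f_{old}\leftarrow f_{new};\ f_{new}\leftarrow f(x+td)\}$ until $f_{new}\ge f_{old}$. 3. If $t=T/\beta$: set $t\leftarrow T$, $\alpha\leftarrow\beta$, swap the values of $f_{new}$ and $f_{old}$, and then repeat $\{t\leftarrow\alpha t;\ f_{old}\leftarrow f_{new};\ f_{new}\leftarrow f(x+td)\}$ until $f_{new}>f_{old}$. 4. If $\alpha<1$ return $t$; otherwise return $\beta^2t$. Counting convention: every evaluation $f(\cdot)$ in the line search is counted, except that the evaluation of $f(x_j)$ at the start of step $j\ge1$ is not counted, since its value was already computed in step $j-1$; $f(x_0)$ is counted. Gradient evaluations, and function evaluations spent on forming $d_j$, are not counted. *)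

theory Defs
  imports "HOL-Analysis.Analysis" "HOL-Library.While_Combinator" "HOL-Library.Monad_Syntax"
begin

definition strongly_convex :: "real \<Rightarrow> ('a::real_inner \<Rightarrow> real) \<Rightarrow> ('a \<Rightarrow> 'a) \<Rightarrow> bool" where
  \<comment> \<open>here \<open>g\<close> is the gradient of \<open>f\<close>\<close>
  "strongly_convex m f g \<longleftrightarrow>
     0 < m \<and> (\<forall>x y. f y \<ge> f x + g x \<bullet> (y - x) + m / 2 * (norm (y - x))\<^sup>2)"

subsection \<open>Search directions\<close>

text \<open>
  The parameter of the last two constructors is the relative accuracy \<open>\<sigma>'\<close> that determines the
  sampling radius \<open>\<sigma>\<close>. The two exact variants (full gradient, directional derivative) share one
  constructor, since their bounds on \<open>\<gamma>\<close> agree, and may be mixed within one run.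
\<close>

datatype direction_type =
    Exact
  | Approx_Gradient real
  | Approx_Directional real

fun admissible_type :: "direction_type \<Rightarrow> bool" where
  "admissible_type Exact \<longleftrightarrow> True"
| "admissible_type (Approx_Gradient \<sigma>') \<longleftrightarrow> \<sigma>' < 1"
| "admissible_type (Approx_Directional \<sigma>') \<longleftrightarrow> \<sigma>' < 1"

text \<open>\<open>g\<close> is the gradient at the current point, so that \<open>v \<bullet> g\<close> is the derivative in direction \<open>v\<close>.\<close>

fun direction_of_type ::
    "real \<Rightarrow> real \<Rightarrow> real \<Rightarrow> direction_type \<Rightarrow> real ^ 'n \<Rightarrow> real ^ 'n \<Rightarrow> bool" where
  "direction_of_type m L \<Delta> Exact g d \<longleftrightarrow>
     d = - g \<or> (\<exists>v. norm v = 1 \<and> d = - (v \<bullet> g) *\<^sub>R v)"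
| "direction_of_type m L \<Delta> (Approx_Gradient \<sigma>') g d \<longleftrightarrow>
     (let n = real CARD('n); \<sigma> = 2 * \<sigma>' * m * \<Delta> / (L * sqrt n)
      in \<exists>\<rho>. norm \<rho> \<le> L * \<sigma> * sqrt n / 2 \<and> d = - g + \<rho>)"
| "direction_of_type m L \<Delta> (Approx_Directional \<sigma>') g d \<longleftrightarrow>
     (let \<sigma> = 2 * \<sigma>' * m * \<Delta> / L
      in \<exists>v \<rho>. norm v = 1 \<and> \<bar>\<rho>\<bar> \<le> L * \<sigma> / 2 \<and> d = (- (v \<bullet> g) + \<rho>) *\<^sub>R v)"

fun gamma_min :: "direction_type \<Rightarrow> real" where
  "gamma_min Exact = 1"
| "gamma_min (Approx_Gradient \<sigma>') = (1 - \<sigma>') / (1 + \<sigma>')\<^sup>2"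
| "gamma_min (Approx_Directional \<sigma>') = 1 / (1 + \<sigma>')"

fun gamma_max :: "direction_type \<Rightarrow> real" where
  "gamma_max Exact = 1"
| "gamma_max (Approx_Gradient \<sigma>') = 1 / (1 - \<sigma>')"
| "gamma_max (Approx_Directional \<sigma>') = 1 / (1 - \<sigma>')"

subsection \<open>Approximately exact line search\<close>

text \<open>
  The search state is \<open>(t, f_old, f_new, c)\<close>, where \<open>c\<close> counts the function evaluations so far.
  The loops need not terminate for arbitrary \<open>f\<close>; \<^term>\<open>None\<close> stands for divergence.
\<close>

type_synonym search_state = "real \<times> real \<times> real \<times> nat"

fun search_step :: "(real \<Rightarrow> real) \<Rightarrow> real \<Rightarrow> search_state \<Rightarrow> search_state" where
  "search_step \<phi> \<alpha> (t, f_old, f_new, c) = (\<alpha> * t, f_new, \<phi> (\<alpha> * t), Suc c)"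

definition repeat_until ::
    "(real \<Rightarrow> real) \<Rightarrow> real \<Rightarrow> (real \<Rightarrow> real \<Rightarrow> bool) \<Rightarrow> search_state \<Rightarrow> search_state option" where
  \<comment> \<open>the body runs once before the first test of \<open>stop f_old f_new\<close>\<close>
  "repeat_until \<phi> \<alpha> stop s =
     while_option (\<lambda>(t, f_old, f_new, c). \<not> stop f_old f_new) (search_step \<phi> \<alpha>) (search_step \<phi> \<alpha> s)"

text \<open>
  The result consists of the step size and the number of all function evaluations, including that
  of \<open>f x\<close>.
\<close>

definition AELS ::
    "('a::real_vector \<Rightarrow> real) \<Rightarrow> 'a \<Rightarrow> real \<Rightarrow> real \<Rightarrow> 'a \<Rightarrow> (real \<times> nat) option" where
  "AELS f x T \<beta> d =
    (let \<phi> = (\<lambda>t. f (x + t *\<^sub>R d));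
         \<alpha> = (if \<phi> T \<le> f x then 1 / \<beta> else \<beta>)
     in do {
       (t, f_old, f_new, c) \<leftarrow>
         repeat_until \<phi> \<alpha> (\<lambda>f_old f_new. f_new \<ge> f_old) (T, f x, \<phi> T, 2);
       (t, \<alpha>, c) \<leftarrow>
         (if t = T / \<beta>
          then do {
            (t, _, _, c) \<leftarrow>
              repeat_until \<phi> \<beta> (\<lambda>f_old f_new. f_new > f_old) (T, f_new, f_old, c);
            Some (t, \<beta>, c)
          }
          else Some (t, \<alpha>, c));
       Some (if \<alpha> < 1 then t else \<beta>\<^sup>2 * t, c)
     })"

subsection \<open>Descent method\<close>

text \<open>
  The state after \<open>j\<close> steps consists of the iterate with index \<open>j\<close>, the step size with index
  \<open>j - 1\<close> (with \<open>T0\<close> in the role of step size \<open>-1\<close>), and the number of counted evaluations: every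
  line search except the first one reuses the already known value of \<open>f\<close> at its starting point.
\<close>

primrec descent ::
    "('a::real_vector \<Rightarrow> real) \<Rightarrow> real \<Rightarrow> real \<Rightarrow> 'a \<Rightarrow> (nat \<Rightarrow> 'a) \<Rightarrow> nat \<Rightarrow> ('a \<times> real \<times> nat) option"
where
  "descent f \<beta> T0 x0 d 0 = Some (x0, T0, 0)"
| "descent f \<beta> T0 x0 d (Suc j) = do {
     (x, t, N) \<leftarrow> descent f \<beta> T0 x0 d j;
     (t', c) \<leftarrow> AELS f x (t / \<beta>) \<beta> (d j);
     Some (x + t' *\<^sub>R d j, t', N + (if j = 0 then c else c - 1))
   }"

end

theory Submission
  imports Defs
begin

text \<open>
  Along a descent direction, \<open>f\<close> is strictly unimodal with a minimizer \<open>s\<close> in \<open>[A, B]\<close>, where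
  \<open>A = gamma_min * (1 - sqrt (1 - m / L)) / m\<close> and \<open>B = gamma_max * (1 + sqrt (1 - m / L)) / m\<close>.
  The line search returns \<open>r\<close> with \<open>r < s < r / \<beta>\<^sup>2\<close>, and apart from a bounded overhead it spends
  one evaluation per factor \<open>\<beta>\<close> between its initial and its final step size. Hence all step sizes
  lie strictly between \<open>\<beta>\<^sup>2 * A\<close> and \<open>B\<close>. The strictness, together with the integrality of the
  count, saves one evaluation per step, which makes each line search fit the bound on its own; the
  first one also pays the additive term.
\<close>

section \<open>Line search on a strictly unimodal function\<close>

lemma repeat_until_eq:
  assumes "stop (\<phi> (\<alpha> ^ n * t)) (\<phi> (\<alpha> ^ Suc n * t))"
    and "\<And>i. i < n \<Longrightarrow> \<not> stop (\<phi> (\<alpha> ^ i * t)) (\<phi> (\<alpha> ^ Suc i * t))"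
  shows "repeat_until \<phi> \<alpha> stop (t, f_old, \<phi> t, c) =
    Some (\<alpha> ^ Suc n * t, \<phi> (\<alpha> ^ n * t), \<phi> (\<alpha> ^ Suc n * t), c + Suc n)"
  using assms
\<comment> \<open>Unfolding the loop once moves the start from \<open>t\<close> to
  \<open>\<alpha> * t\<close>. The value \<open>f_old\<close> may vary, since the body overwrites it
  before the first test.\<close>
proof (induction n arbitrary: t f_old c)
  case 0
  then show ?case
    by (simp add: repeat_until_def while_option_unfold)
next
  case (Suc n)
  have "\<not> stop (\<phi> t) (\<phi> (\<alpha> * t))"
    using Suc.prems(2)[of 0] by simp
  then have "repeat_until \<phi> \<alpha> stop (t, f_old, \<phi> t, c) =
      repeat_until \<phi> \<alpha> stop (\<alpha> * t, \<phi> t, \<phi> (\<alpha> * t), Suc c)"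
    unfolding repeat_until_def by (subst while_option_unfold) simp
  also have "\<dots> = Some (\<alpha> ^ Suc n * (\<alpha> * t), \<phi> (\<alpha> ^ n * (\<alpha> * t)),
      \<phi> (\<alpha> ^ Suc n * (\<alpha> * t)), Suc c + Suc n)"
  proof (rule Suc.IH)
    show "stop (\<phi> (\<alpha> ^ n * (\<alpha> * t))) (\<phi> (\<alpha> ^ Suc n * (\<alpha> * t)))"
      using Suc.prems(1) by (simp add: mult_ac)
    show "\<not> stop (\<phi> (\<alpha> ^ i * (\<alpha> * t))) (\<phi> (\<alpha> ^ Suc i * (\<alpha> * t)))" if "i < n" for i
      using Suc.prems(2)[of "Suc i"] that by (simp add: mult_ac)
  qed
  finally show ?case
    by (simp add: mult_ac)
qed

text \<open>Shrinking a step that is at most \<open>s\<close> strictly increases the value;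
  shrinking to a point at or above \<open>s\<close> strictly decreases it. So the loop ends below
  \<open>s\<close>, less than two factors \<open>\<beta>\<close> away. The test \<open>stop\<close>
  is only pinned between \<open><\<close> and \<open>\<le>\<close>, which serves both backtracking
  loops of the search.\<close>

lemma repeat_until_backtrack:
  fixes \<phi> :: "real \<Rightarrow> real"
  assumes beta: "0 < \<beta>" "\<beta> < 1" and T: "0 < T" and s: "0 < s" "s < T / \<beta>"
    and dec: "strict_antimono_on {0..s} \<phi>" and inc: "strict_mono_on {s..} \<phi>"
    and stop: "\<And>a b. a < b \<Longrightarrow> stop a b" "\<And>a b. stop a b \<Longrightarrow> a \<le> b"
  obtains n where "repeat_until \<phi> \<beta> stop (T, f_old, \<phi> T, c) =
      Some (\<beta> ^ Suc n * T, \<phi> (\<beta> ^ n * T), \<phi> (\<beta> ^ Suc n * T), c + Suc n)"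
    and "\<beta> ^ Suc n * T < s" "s < \<beta> ^ Suc n * T / \<beta>\<^sup>2"
proof -
  define P where "P n \<longleftrightarrow> stop (\<phi> (\<beta> ^ n * T)) (\<phi> (\<beta> ^ Suc n * T))" for n
  have shrink: "0 < \<beta> ^ Suc n * T" "\<beta> ^ Suc n * T < \<beta> ^ n * T" for n
    using beta T by simp_all
  have below: "\<phi> (\<beta> ^ n * T) < \<phi> (\<beta> ^ Suc n * T)" if "\<beta> ^ n * T \<le> s" for n
    using monotone_onD[OF dec, of "\<beta> ^ Suc n * T" "\<beta> ^ n * T"] shrink[of n] that by simp
  obtain N where "\<beta> ^ N < s / T"
    using real_arch_pow_inv[of "s / T" \<beta>] beta T s by auto
  then have "P N"
    unfolding P_def using T by (intro stop(1) below) (simp add: field_simps)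
  define n where "n = (LEAST n. P n)"
  have n: "P n" and least: "\<And>i. i < n \<Longrightarrow> \<not> P i"
    unfolding n_def using \<open>P N\<close> by (auto intro: LeastI dest: not_less_Least)
  show thesis
  proof (rule that)
    show "repeat_until \<phi> \<beta> stop (T, f_old, \<phi> T, c) =
        Some (\<beta> ^ Suc n * T, \<phi> (\<beta> ^ n * T), \<phi> (\<beta> ^ Suc n * T), c + Suc n)"
      using n least unfolding P_def by (rule repeat_until_eq)
    show "\<beta> ^ Suc n * T < s"
    proof (rule ccontr)
      assume "\<not> \<beta> ^ Suc n * T < s"
      then have "\<phi> (\<beta> ^ Suc n * T) < \<phi> (\<beta> ^ n * T)"
        using shrink[of n] by (intro monotone_onD[OF inc]) auto
      then show False
        using stop(2) n unfolding P_def by fastforce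
    qed
    show "s < \<beta> ^ Suc n * T / \<beta>\<^sup>2"
    \<comment> \<open>If the first test succeeds, the bound is the hypothesis
      \<open>s < T / \<beta>\<close>; otherwise the last failed test forces
      \<open>\<beta> ^ i * T\<close> above \<open>s\<close>.\<close>
    proof (cases n)
      case 0
      then show ?thesis
        using s beta by (simp add: power2_eq_square)
    next
      case (Suc i)
      then have "\<not> \<beta> ^ i * T \<le> s"
        using least[of i] below[of i] stop(1) unfolding P_def by auto
      then show ?thesis
        using Suc beta by (simp add: power2_eq_square)
    qed
  qed
qed

lemma log_inverse_base_power:
  fixes \<beta> :: real
  assumes "0 < \<beta>" "\<beta> < 1" "0 < x"
  shows "log (1 / \<beta>) (\<beta> ^ n * x) = log (1 / \<beta>) x - n"
proof -
  have "log (1 / \<beta>) \<beta> = - 1"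
    using assms by (simp add: log_def ln_div)
  then show ?thesis
    using assms by (simp add: log_mult log_nat_power)
qed

text \<open>There are three outcomes: backtracking from \<open>T\<close>, backtracking after one
  failed growth step, and growth. In each, the tests near the end locate \<open>s\<close>, and
  logarithms to base \<open>1 / \<beta>\<close> count the loop runs. The first bound on
  \<open>c\<close> belongs to growth, the second to backtracking.\<close>

lemma AELS_bounds:
  assumes beta: "0 < \<beta>" "\<beta> < 1" and T: "0 < T" and s: "0 < s"
    and dec: "strict_antimono_on {0..s} (\<lambda>t. f (x + t *\<^sub>R d))"
    and inc: "strict_mono_on {s..} (\<lambda>t. f (x + t *\<^sub>R d))"
  obtains r c where "AELS f x T \<beta> d = Some (r, c)" "r < s" "s < r / \<beta>\<^sup>2" "1 \<le> c"
    "real c < 4 + log (1 / \<beta>) (s / T) \<or> real c < 5 + log (1 / \<beta>) (T / s)"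
proof -
  define \<phi> where "\<phi> t = f (x + t *\<^sub>R d)" for t
  note dec = dec[folded \<phi>_def] and inc = inc[folded \<phi>_def]
  have f_x: "f x = \<phi> 0"
    by (simp add: \<phi>_def)
  have base: "1 < 1 / \<beta>"
    using beta by simp
  \<comment> \<open>The constant 3 covers the two initial evaluations and a possible failed growth
    step.\<close>
  have backtrack_count: "real c < 5 + log (1 / \<beta>) (T / s)"
    if "s < \<beta> ^ Suc n * T / \<beta>\<^sup>2" "c \<le> 3 + Suc n" for n c
  proof -
    have "\<beta> ^ 2 * s < \<beta> ^ Suc n * T"
      using that(1) beta by (simp add: field_simps)
    then have "log (1 / \<beta>) (\<beta> ^ 2 * s) < log (1 / \<beta>) (\<beta> ^ Suc n * T)"
      using beta s T base by (subst log_less_cancel_iff) simp_all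
    then have "real (Suc n) < 2 + log (1 / \<beta>) (T / s)"
      unfolding log_inverse_base_power[OF beta s] log_inverse_base_power[OF beta T]
      using s T by (simp add: log_divide)
    then show ?thesis
      using that(2) by linarith
  qed
  show thesis
  proof (cases "\<phi> T \<le> \<phi> 0")
    case False
    \<comment> \<open>Since \<open>\<phi>\<close> decreases up to \<open>s\<close>,
      \<open>T \<le> s\<close> would contradict \<open>\<phi> T > \<phi> 0\<close>.\<close>
    have "s < T"
      using monotone_onD[OF dec, of 0 T] False T by force
    moreover have "T < T / \<beta>"
      using beta T by (simp add: pos_less_divide_eq)
    ultimately have sT: "s < T / \<beta>"
      by simp
    obtain n where n: "repeat_until \<phi> \<beta> (\<lambda>f_old f_new. f_new \<ge> f_old) (T, \<phi> 0, \<phi> T, 2) =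
        Some (\<beta> ^ Suc n * T, \<phi> (\<beta> ^ n * T), \<phi> (\<beta> ^ Suc n * T), 2 + Suc n)"
      and r: "\<beta> ^ Suc n * T < s" "s < \<beta> ^ Suc n * T / \<beta>\<^sup>2"
      by (rule repeat_until_backtrack[where stop = "\<lambda>f_old f_new. f_new \<ge> f_old",
            OF beta T s sT dec inc less_imp_le])
    \<comment> \<open>This rules out \<open>t = T / \<beta>\<close>, so the second loop is
      skipped.\<close>
    have "\<beta> ^ Suc n * T < T / \<beta>"
      using r sT by linarith
    then have "AELS f x T \<beta> d = Some (\<beta> ^ Suc n * T, 2 + Suc n)"
      using n False beta by (simp add: AELS_def Let_def f_x flip: \<phi>_def)
    then show thesis
      using that r backtrack_count[OF r(2), of "2 + Suc n"] by simp
  next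
    case True
    define P where "P n \<longleftrightarrow> \<phi> ((1 / \<beta>) ^ n * T) \<le> \<phi> ((1 / \<beta>) ^ Suc n * T)" for n
    have grow: "0 < (1 / \<beta>) ^ n * T" "(1 / \<beta>) ^ n * T < (1 / \<beta>) ^ Suc n * T" for n
      using beta T by (simp_all add: field_simps)
    \<comment> \<open>Once a step exceeds \<open>s\<close>, further growth increases
      \<open>\<phi>\<close>, so the loop terminates.\<close>
    obtain N where "s / T < (1 / \<beta>) ^ N"
      using real_arch_pow[OF base] by blast
    then have "P N"
      unfolding P_def using T grow[of N]
      by (intro less_imp_le monotone_onD[OF inc]) (auto simp: field_simps)
    define n where "n = (LEAST n. P n)"
    have n: "P n" and least: "\<And>i. i < n \<Longrightarrow> \<not> P i"
      unfolding n_def using \<open>P N\<close> by (auto intro: LeastI dest: not_less_Least)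
    have forward: "repeat_until \<phi> (1 / \<beta>) (\<lambda>f_old f_new. f_new \<ge> f_old) (T, \<phi> 0, \<phi> T, 2) =
        Some ((1 / \<beta>) ^ Suc n * T, \<phi> ((1 / \<beta>) ^ n * T), \<phi> ((1 / \<beta>) ^ Suc n * T), 2 + Suc n)"
      using n least unfolding P_def by (rule repeat_until_eq)
    have s_less: "s < (1 / \<beta>) ^ Suc n * T"
    proof (rule ccontr)
      assume "\<not> s < (1 / \<beta>) ^ Suc n * T"
      then have "\<phi> ((1 / \<beta>) ^ Suc n * T) < \<phi> ((1 / \<beta>) ^ n * T)"
        using grow[of n] by (intro monotone_onD[OF dec]) auto
      then show False
        using n unfolding P_def by simp
    qed
    show thesis
    proof (cases n)
      \<comment> \<open>The first growth step fails, so the search restarts at \<open>T\<close> with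
        the two values swapped and three evaluations spent. Here \<open>s\<close> may lie on either
        side of \<open>T\<close>; \<open>s < T / \<beta>\<close> suffices.\<close>
      case 0
      then have sT: "s < T / \<beta>"
        using s_less by simp
      obtain q where q: "repeat_until \<phi> \<beta> (\<lambda>f_old f_new. f_new > f_old)
            (T, \<phi> (T / \<beta>), \<phi> T, 3) =
          Some (\<beta> ^ Suc q * T, \<phi> (\<beta> ^ q * T), \<phi> (\<beta> ^ Suc q * T), 3 + Suc q)"
        and r: "\<beta> ^ Suc q * T < s" "s < \<beta> ^ Suc q * T / \<beta>\<^sup>2"
        by (rule repeat_until_backtrack[where stop = "\<lambda>f_old f_new. f_new > f_old",
              OF beta T s sT dec inc _ less_imp_le])
      have "AELS f x T \<beta> d = Some (\<beta> ^ Suc q * T, 3 + Suc q)"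
        using forward q True beta 0 by (simp add: AELS_def Let_def f_x flip: \<phi>_def)
      then show thesis
        using that r backtrack_count[OF r(2), of "3 + Suc q"] by simp
    next
      case (Suc i)
      \<comment> \<open>The returned step: the factor \<open>\<beta>\<^sup>2\<close> undoes the last
        two growth steps. The test that failed at \<open>i\<close> puts \<open>?r\<close> below
        \<open>s\<close>.\<close>
      let ?r = "(1 / \<beta>) ^ i * T"
      have r: "?r < s"
      proof (rule ccontr)
        assume "\<not> ?r < s"
        then have "\<phi> ?r < \<phi> ((1 / \<beta>) ^ Suc i * T)"
          using grow[of i] by (intro monotone_onD[OF inc]) auto
        then show False
          using least[of i] Suc unfolding P_def by simp
      qed
      have "1 < (1 / \<beta>) ^ Suc i"
        using base by (rule one_less_power) simp
      then have "T / \<beta> < (1 / \<beta>) ^ Suc n * T"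
        using T beta Suc by (simp add: field_simps)
      moreover have "\<beta>\<^sup>2 * ((1 / \<beta>) ^ Suc n * T) = ?r"
        using Suc beta by (simp add: power2_eq_square)
      ultimately have "AELS f x T \<beta> d = Some (?r, 4 + i)"
        using forward True beta Suc by (simp add: AELS_def Let_def f_x flip: \<phi>_def)
      moreover have "s < ?r / \<beta>\<^sup>2"
        using s_less Suc by (simp add: power2_eq_square)
      moreover have "real (4 + i) < 4 + log (1 / \<beta>) (s / T)"
      proof -
        have "log (1 / \<beta>) ((1 / \<beta>) ^ i) < log (1 / \<beta>) (s / T)"
          using r base T s beta by (subst log_less_cancel_iff) (simp_all add: field_simps)
        then show ?thesis
          using beta by (subst (asm) log_pow_cancel) simp_all
      qed
      ultimately show thesis
        using that r by simp
    qed
  qed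
qed

section \<open>Strong convexity along a search direction\<close>

lemma strongly_convex_monotone:
  assumes "strongly_convex m f g"
  shows "m * (norm (y - x))\<^sup>2 \<le> (g y - g x) \<bullet> (y - x)"
proof -
  have "f x + g x \<bullet> (y - x) + m / 2 * (norm (y - x))\<^sup>2 \<le> f y"
    and "f y + g y \<bullet> (x - y) + m / 2 * (norm (x - y))\<^sup>2 \<le> f x"
    using assms unfolding strongly_convex_def by blast+
  then show ?thesis
    by (simp add: norm_minus_commute[of x y] inner_diff_left inner_diff_right)
qed

text \<open>Strong monotonicity bounds the growth of \<open>g\<close> from below, Cauchy-Schwarz and
  the Lipschitz condition from above. The vector \<open>z\<close> excludes the trivial
  space.\<close>

lemma strongly_convex_le_lipschitz:
  fixes f :: "'a::real_inner \<Rightarrow> real" and z :: 'a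
  assumes "strongly_convex m f g" "L-lipschitz_on UNIV g" and "z \<noteq> 0"
  shows "m \<le> L"
proof -
  have "m * (norm z)\<^sup>2 \<le> (g z - g 0) \<bullet> z"
    using strongly_convex_monotone[OF assms(1), of z 0] by simp
  also have "\<dots> \<le> norm (g z - g 0) * norm z"
    by (rule norm_cauchy_schwarz)
  also have "\<dots> \<le> L * norm z * norm z"
    using lipschitz_onD[OF assms(2), of z 0] by (intro mult_right_mono) (simp_all add: dist_norm)
  finally show ?thesis
    using assms(3) by (simp add: power2_eq_square)
qed

text \<open>The slope \<open>\<phi>'\<close> along \<open>d\<close> starts at
  \<open>- (D * \<gamma>)\<close> and grows at rates between \<open>m * D\<close> and
  \<open>L * D\<close>, so it vanishes between \<open>\<gamma> / L\<close> and
  \<open>\<gamma> / m\<close>.\<close>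

lemma strongly_convex_unimodal:
  fixes f :: "'a::real_inner \<Rightarrow> real"
  assumes convex: "strongly_convex m f g" and lipschitz: "L-lipschitz_on UNIV g"
    and descent: "d \<bullet> g x < 0"
  defines "\<gamma> \<equiv> - (d \<bullet> g x) / (norm d)\<^sup>2"
  obtains s where "\<gamma> / L \<le> s" "s \<le> \<gamma> / m"
    "strict_antimono_on {0..s} (\<lambda>t. f (x + t *\<^sub>R d))"
    "strict_mono_on {s..} (\<lambda>t. f (x + t *\<^sub>R d))"
proof -
  define D where "D = (norm d)\<^sup>2"
  define \<phi>' where "\<phi>' t = d \<bullet> g (x + t *\<^sub>R d)" for t
  have "d \<noteq> 0"
    using descent by auto
  then have D: "0 < D"
    by (simp add: D_def)
  have m: "0 < m"
    using convex by (simp add: strongly_convex_def)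
  have L: "0 < L"
    using strongly_convex_le_lipschitz[OF convex lipschitz \<open>d \<noteq> 0\<close>] m by simp
  have \<gamma>: "\<phi>' 0 = - (D * \<gamma>)" "0 < \<gamma>"
    using descent D by (simp_all add: \<gamma>_def \<phi>'_def D_def divide_neg_pos)
  have lower: "f (x + t *\<^sub>R d) + \<phi>' t * (u - t) + m / 2 * D * (u - t)\<^sup>2 \<le> f (x + u *\<^sub>R d)" for t u
  proof -
    have "(x + u *\<^sub>R d) - (x + t *\<^sub>R d) = (u - t) *\<^sub>R d"
      by (simp add: algebra_simps)
    moreover have "f (x + t *\<^sub>R d) + g (x + t *\<^sub>R d) \<bullet> ((x + u *\<^sub>R d) - (x + t *\<^sub>R d))
        + m / 2 * (norm ((x + u *\<^sub>R d) - (x + t *\<^sub>R d)))\<^sup>2 \<le> f (x + u *\<^sub>R d)"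
      using convex unfolding strongly_convex_def by blast
    ultimately show ?thesis
      by (simp add: \<phi>'_def D_def power_mult_distrib inner_commute mult_ac)
  qed
  have slope_lower: "m * D * (u - t) \<le> \<phi>' u - \<phi>' t" if "t \<le> u" for t u
  proof (cases "t = u")
    case False
    \<comment> \<open>Adding \<open>lower\<close> in both directions cancels the function values;
      then \<open>u - t\<close> is divided out.\<close>
    have "\<phi>' u * (t - u) = - (\<phi>' u * (u - t))"
      by (simp add: algebra_simps)
    then have "m * D * (u - t)\<^sup>2 \<le> \<phi>' u * (u - t) - \<phi>' t * (u - t)"
      using lower[of t u] lower[of u t] power2_commute[of t u] by simp
    then have "m * D * (u - t) * (u - t) \<le> (\<phi>' u - \<phi>' t) * (u - t)"
      by (simp add: power2_eq_square left_diff_distrib mult.assoc)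
    then show ?thesis
      using False that by (subst (asm) mult_le_cancel_right_pos) simp_all
  qed simp
  have slope_upper: "\<bar>\<phi>' u - \<phi>' t\<bar> \<le> L * D * \<bar>u - t\<bar>" for t u
  proof -
    have "\<bar>\<phi>' u - \<phi>' t\<bar> \<le> norm d * norm (g (x + u *\<^sub>R d) - g (x + t *\<^sub>R d))"
      unfolding \<phi>'_def inner_diff_right[symmetric] by (rule Cauchy_Schwarz_ineq2)
    also have "\<dots> \<le> norm d * (L * norm ((u - t) *\<^sub>R d))"
      using lipschitz_onD[OF lipschitz, of "x + u *\<^sub>R d" "x + t *\<^sub>R d"]
      by (intro mult_left_mono) (simp_all add: dist_norm algebra_simps)
    also have "\<dots> = L * D * \<bar>u - t\<bar>"
      by (simp add: D_def power2_eq_square)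
    finally show ?thesis .
  qed
  have "(L * D)-lipschitz_on {0..\<gamma> / m} \<phi>'"
    using slope_upper L D by (intro lipschitz_onI) (simp_all add: dist_real_def)
  then have "continuous_on {0..\<gamma> / m} \<phi>'"
    by (rule lipschitz_on_continuous_on)
  moreover have "\<phi>' 0 \<le> 0"
    using descent by (simp add: \<phi>'_def)
  \<comment> \<open>Growing at rate at least \<open>m * D\<close>, the slope makes up its initial
    deficit \<open>D * \<gamma>\<close> by \<open>\<gamma> / m\<close>.\<close>
  moreover have "0 \<le> \<phi>' (\<gamma> / m)"
    using slope_lower[of 0 "\<gamma> / m"] \<gamma> m by simp
  ultimately obtain s where s: "0 \<le> s" "s \<le> \<gamma> / m" "\<phi>' s = 0"
    using IVT'[of \<phi>' 0 0 "\<gamma> / m"] \<gamma> m by auto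
  show thesis
  proof (rule that)
    have "D * \<gamma> \<le> D * (L * s)"
      using slope_upper[of s 0] s \<gamma> D by (simp add: mult_ac)
    then show "\<gamma> / L \<le> s"
      using D L by (simp add: pos_divide_le_eq mult.commute)
    show "s \<le> \<gamma> / m"
      by fact
    show "strict_antimono_on {0..s} (\<lambda>t. f (x + t *\<^sub>R d))"
    proof (rule monotone_onI)
      fix t u assume *: "t \<in> {0..s}" "u \<in> {0..s}" "t < u"
      have "0 \<le> m * D * (s - u)"
        using * m D by simp
      then have "\<phi>' u \<le> 0"
        using slope_lower[of u s] * s by simp
      then have "0 \<le> \<phi>' u * (t - u)"
        using * by (simp add: mult_nonpos_nonpos)
      moreover have "0 < m / 2 * D * (t - u)\<^sup>2"
        using * m D by simp
      \<comment> \<open>The convexity bound is taken at the point nearer to \<open>s\<close>, here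
        \<open>u\<close>; the quadratic term gives strictness.\<close>
      ultimately show "f (x + t *\<^sub>R d) > f (x + u *\<^sub>R d)"
        using lower[of u t] by linarith
    qed
    show "strict_mono_on {s..} (\<lambda>t. f (x + t *\<^sub>R d))"
    proof (rule monotone_onI)
      fix t u assume *: "t \<in> {s..}" "u \<in> {s..}" "t < u"
      have "0 \<le> m * D * (t - s)"
        using * m D by simp
      then have "0 \<le> \<phi>' t"
        using slope_lower[of s t] * s by simp
      then have "0 \<le> \<phi>' t * (u - t)"
        using * by simp
      moreover have "0 < m / 2 * D * (u - t)\<^sup>2"
        using * m D by simp
      ultimately show "f (x + t *\<^sub>R d) < f (x + u *\<^sub>R d)"
        using lower[of t u] by linarith
    qed
  qed
qed

section \<open>Positivity of the bounds on \<gamma>\<close>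

lemma gamma_pos:
  fixes g d :: "real ^ 'n"
  assumes "admissible_type ty" "direction_of_type m L \<Delta> ty g d" "0 < m" "0 < L" "0 < \<Delta>"
  shows "0 < gamma_min ty" "0 < gamma_max ty"
proof -
  \<comment> \<open>Admissibility only bounds \<open>\<sigma>'\<close> from above. Nonnegativity
    comes from the direction: its error bound simplifies to
    \<open>\<sigma>' * (m * \<Delta>)\<close> and dominates a norm or an absolute value.\<close>
  have accuracy: "0 \<le> \<sigma>'" if "0 \<le> \<sigma>' * (m * \<Delta>)" for \<sigma>'
    using that assms(3,5) by (simp add: zero_le_mult_iff) (meson less_le_trans linorder_not_less mult_pos_pos)
  have "0 < gamma_min ty \<and> 0 < gamma_max ty"
  proof (cases ty)
    case Exact
    then show ?thesis by simp
  next
    case (Approx_Gradient \<sigma>')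
    obtain \<rho> :: "real ^ 'n" where "norm \<rho> \<le> L * (2 * \<sigma>' * m * \<Delta> / (L * sqrt CARD('n))) * sqrt CARD('n) / 2"
      using assms(2) unfolding Approx_Gradient direction_of_type.simps Let_def by blast
    also have "\<dots> = \<sigma>' * (m * \<Delta>)"
      using assms(4) by simp
    finally have "0 \<le> \<sigma>'"
      using accuracy norm_ge_zero order_trans by blast
    then show ?thesis
      using Approx_Gradient assms(1) by simp
  next
    case (Approx_Directional \<sigma>')
    obtain \<rho> :: real where "\<bar>\<rho>\<bar> \<le> L * (2 * \<sigma>' * m * \<Delta> / L) / 2"
      using assms(2) unfolding Approx_Directional direction_of_type.simps Let_def by blast
    also have "\<dots> = \<sigma>' * (m * \<Delta>)"
      using assms(4) by simp
    finally have "0 \<le> \<sigma>'"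
      using accuracy abs_ge_zero order_trans by blast
    then show ?thesis
      using Approx_Directional assms(1) by simp
  qed
  then show "0 < gamma_min ty" "0 < gamma_max ty"
    by simp_all
qed

section \<open>Evaluation count of the whole descent\<close>

theorem theorem2:
  fixes f :: "real ^ 'n \<Rightarrow> real"
    and g :: "real ^ 'n \<Rightarrow> real ^ 'n"
    and m L \<Delta> T0 \<beta> :: real
    and x0 x_min :: "real ^ 'n"
    and d :: "nat \<Rightarrow> real ^ 'n"
    and ty :: direction_type
    and k :: nat
  assumes gradient: "\<And>x. GDERIV f x :> g x"
    and strongly_convex: "strongly_convex m f g"
    and lipschitz: "L-lipschitz_on UNIV g"
    and minimizer: "\<And>y. f x_min \<le> f y"
    and tolerance: "0 < \<Delta>"
    and T0: "0 < T0"
    and beta: "0 < \<beta>" "\<beta> < 1"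
    and k: "1 \<le> k"
    and type: "admissible_type ty"
    and not_terminated:
      "\<And>j x t N. j < k \<Longrightarrow> descent f \<beta> T0 x0 d j = Some (x, t, N) \<Longrightarrow> \<Delta> \<le> norm (x - x_min)"
    and descent_direction:
      "\<And>j x t N. j < k \<Longrightarrow> descent f \<beta> T0 x0 d j = Some (x, t, N) \<Longrightarrow> d j \<bullet> g x < 0"
    and direction_type:
      "\<And>j x t N. j < k \<Longrightarrow> descent f \<beta> T0 x0 d j = Some (x, t, N) \<Longrightarrow>
         direction_of_type m L \<Delta> ty (g x) (d j)"
    and gamma_bounds:
      "\<And>j x t N. j < k \<Longrightarrow> descent f \<beta> T0 x0 d j = Some (x, t, N) \<Longrightarrow>
         - (d j \<bullet> g x) / (norm (d j))\<^sup>2 \<in> {gamma_min ty..gamma_max ty}"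
  shows "\<exists>x t N. descent f \<beta> T0 x0 d k = Some (x, t, N) \<and>
    int N \<le> int k * (4 + \<lceil>log (1 / \<beta>) ((gamma_max ty * (1 + sqrt (1 - m / L)))
                                      / (gamma_min ty * (1 - sqrt (1 - m / L))))\<rceil>)
          + \<lceil>log (1 / \<beta>) (max (\<beta>\<^sup>2 * gamma_min ty * (1 - sqrt (1 - m / L)) / (m * T0))
                              (m * T0 / (\<beta> * gamma_max ty * (1 + sqrt (1 - m / L)))))\<rceil>"
proof -
  define A where "A = gamma_min ty * (1 - sqrt (1 - m / L)) / m"
  define B where "B = gamma_max ty * (1 + sqrt (1 - m / L)) / m"
  define lg where "lg = log (1 / \<beta>)"
  define b where "b = 4 + \<lceil>lg (B / A)\<rceil>"
  define E where "E = \<lceil>lg (max (\<beta>\<^sup>2 * A / T0) (T0 / (\<beta> * B)))\<rceil>"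
  have m: "0 < m"
    using strongly_convex by (simp add: strongly_convex_def)
  have "d 0 \<noteq> 0"
    using descent_direction[of 0] k by force
  then have mL: "m \<le> L"
    using strongly_convex_le_lipschitz strongly_convex lipschitz by blast
  then have L: "0 < L"
    using m by simp
  have gamma: "0 < gamma_min ty" "0 < gamma_max ty"
    using gamma_pos[OF type direction_type[of 0] m L tolerance] k by simp_all
  \<comment> \<open>Since \<open>(1 - w) * (1 + w) = m / L\<close>, the interval from
    \<open>A\<close> to \<open>B\<close> contains the one from \<open>gamma_min ty / L\<close> to
    \<open>gamma_max ty / m\<close>, where the line minimizers lie.\<close>
  define w where "w = sqrt (1 - m / L)"
  have w: "0 \<le> w" "w < 1"
    using m mL by (simp_all add: w_def)
  have "m / L = (1 - w) * (1 + w)"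
    using m mL by (simp add: w_def algebra_simps flip: power2_eq_square)
  moreover have "1 - w \<le> (1 - w) * (1 + w)"
    using w by (simp add: algebra_simps mult_left_le)
  ultimately have "1 - w \<le> m / L"
    by simp
  then have w_le: "(1 - w) / m \<le> 1 / L"
    using m divide_right_mono[of "1 - w" "m / L" m] by simp
  have A: "0 < A" "A \<le> gamma_min ty / L"
    using gamma m w mult_left_mono[OF w_le, of "gamma_min ty"] by (simp_all add: A_def flip: w_def)
  have B: "0 < B" "gamma_max ty / m \<le> B"
    using gamma m w by (auto simp: B_def divide_right_mono simp flip: w_def)
  have base: "1 < 1 / \<beta>"
    using beta by simp
  have lg_mono: "lg u \<le> lg v" if "0 < u" "u \<le> v" for u v
    using that base by (simp add: lg_def)
  have lg_less: "lg u < lg v" if "0 < u" "u < v" for u v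
    using that base by (simp add: lg_def)
  have lg_div: "lg (u / v) = lg u - lg v" if "0 < u" "0 < v" for u v
    using that by (simp add: lg_def log_divide)
  have lg_beta: "lg (\<beta> * u) = lg u - 1" "lg (\<beta>\<^sup>2 * u) = lg u - 2" if "0 < u" for u
    using log_inverse_base_power[OF beta that, of 1] log_inverse_base_power[OF beta that, of 2]
    by (simp_all add: lg_def)

  \<comment> \<open>The search starts from \<open>t / \<beta>\<close>, which shifts the constants 4
    and 5 to 3 and 6. Replacing \<open>s\<close> by \<open>B\<close> or \<open>A\<close> makes the
    bounds independent of the line.\<close>
  have step: "\<exists>x' t' c. descent f \<beta> T0 x0 d (Suc j) = Some (x', t', N + (if j = 0 then c else c - 1))
        \<and> \<beta>\<^sup>2 * A < t' \<and> t' < B \<and> 1 \<le> c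
        \<and> (real c < 3 + (lg B - lg t) \<or> real c < 6 + (lg t - lg A))"
    if j: "j < k" and eq: "descent f \<beta> T0 x0 d j = Some (x, t, N)" and t: "0 < t" for j x t N
  proof -
    let ?\<gamma> = "- (d j \<bullet> g x) / (norm (d j))\<^sup>2"
    obtain s where s: "?\<gamma> / L \<le> s" "s \<le> ?\<gamma> / m"
      and uni: "strict_antimono_on {0..s} (\<lambda>t. f (x + t *\<^sub>R d j))"
        "strict_mono_on {s..} (\<lambda>t. f (x + t *\<^sub>R d j))"
      using strongly_convex_unimodal[OF strongly_convex lipschitz descent_direction[OF j eq]] by blast
    have "gamma_min ty \<le> ?\<gamma>" "?\<gamma> \<le> gamma_max ty"
      using gamma_bounds[OF j eq] by simp_all
    then have "gamma_min ty / L \<le> ?\<gamma> / L" "?\<gamma> / m \<le> gamma_max ty / m"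
      using m L by (simp_all only: divide_right_mono less_imp_le)
    then have AsB: "A \<le> s" "s \<le> B"
      using s A B by linarith+
    then have "0 < s"
      using A by simp
    have "0 < t / \<beta>"
      using t beta by simp
    then obtain r c where r: "AELS f x (t / \<beta>) \<beta> (d j) = Some (r, c)" "r < s" "s < r / \<beta>\<^sup>2" "1 \<le> c"
      and c: "real c < 4 + lg (s / (t / \<beta>)) \<or> real c < 5 + lg (t / \<beta> / s)"
      using AELS_bounds[OF beta _ \<open>0 < s\<close> uni] unfolding lg_def by blast
    have "lg (t / \<beta>) = lg t + 1"
      using lg_beta(1)[of "t / \<beta>"] t beta by simp
    then have "real c < 3 + (lg s - lg t) \<or> real c < 6 + (lg t - lg s)"
      using c unfolding lg_div[OF \<open>0 < s\<close> \<open>0 < t / \<beta>\<close>] lg_div[OF \<open>0 < t / \<beta>\<close> \<open>0 < s\<close>] by linarith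
    then have "real c < 3 + (lg B - lg t) \<or> real c < 6 + (lg t - lg A)"
      using lg_mono[of A s] lg_mono[of s B] A AsB \<open>0 < s\<close> by auto
    moreover have "\<beta>\<^sup>2 * s < r"
      using r(3) beta by (simp add: field_simps)
    then have "\<beta>\<^sup>2 * A < r"
      using mult_left_mono[of A s "\<beta>\<^sup>2"] AsB by simp
    ultimately show ?thesis
      using eq r AsB by auto
  qed

  \<comment> \<open>The induction starts after the first step, since \<open>T0\<close> need not lie
    between the bounds on the later step sizes; \<open>E\<close> pays for this once.\<close>
  have "\<exists>x t N. descent f \<beta> T0 x0 d (Suc j) = Some (x, t, N) \<and> \<beta>\<^sup>2 * A < t \<and> t < B
      \<and> int N \<le> int (Suc j) * b + E" if "Suc j \<le> k" for j
    using that
  proof (induction j)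
    case 0
    then obtain x t c where *: "descent f \<beta> T0 x0 d (Suc 0) = Some (x, t, c)"
        "\<beta>\<^sup>2 * A < t" "t < B"
      and c: "real c < 3 + (lg B - lg T0) \<or> real c < 6 + (lg T0 - lg A)"
      using step[of 0 x0 T0 0] T0 k by auto
    \<comment> \<open>The terms of the maximum are scaled so that in either alternative
      \<open>c\<close> is less than 5 plus the matching sum of logarithms.\<close>
    have "lg (B / A) + lg (\<beta>\<^sup>2 * A / T0) = lg B - lg T0 - 2"
      "lg (B / A) + lg (T0 / (\<beta> * B)) = lg T0 - lg A + 1"
      using A B T0 beta by (simp_all add: lg_div lg_beta)
    moreover have "lg (\<beta>\<^sup>2 * A / T0) \<le> lg (max (\<beta>\<^sup>2 * A / T0) (T0 / (\<beta> * B)))"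
      "lg (T0 / (\<beta> * B)) \<le> lg (max (\<beta>\<^sup>2 * A / T0) (T0 / (\<beta> * B)))"
      using A B T0 beta by (auto intro!: lg_mono)
    moreover have "lg (B / A) + lg (max (\<beta>\<^sup>2 * A / T0) (T0 / (\<beta> * B))) \<le> real_of_int (b - 4 + E)"
      unfolding b_def E_def of_int_add of_int_diff by (simp add: add_mono)
    ultimately have "real c < real_of_int (b + E) + 1"
      using c by auto
    then have "int c \<le> b + E"
      by linarith
    then show ?case
      using * by auto
  next
    case (Suc j)
    then obtain x t N where IH: "descent f \<beta> T0 x0 d (Suc j) = Some (x, t, N)"
        "\<beta>\<^sup>2 * A < t" "t < B" "int N \<le> int (Suc j) * b + E"
      by auto
    have "0 < \<beta>\<^sup>2 * A"
      using beta A by simp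
    then have t: "0 < t"
      using IH by simp
    obtain x' t' c where *: "descent f \<beta> T0 x0 d (Suc (Suc j)) = Some (x', t', N + (c - 1))"
        "\<beta>\<^sup>2 * A < t'" "t' < B" "1 \<le> c"
      and c: "real c < 3 + (lg B - lg t) \<or> real c < 6 + (lg t - lg A)"
      using step[OF _ IH(1) t] Suc.prems by auto
    \<comment> \<open>With these bounds either alternative gives
      \<open>c < 6 + (lg B - lg A)\<close>.\<close>
    have "lg A - 2 < lg t" "lg t < lg B"
      using lg_less[of "\<beta>\<^sup>2 * A" t] lg_less[of t B] IH t \<open>0 < \<beta>\<^sup>2 * A\<close> A by (simp_all add: lg_beta)
    moreover have "lg B - lg A \<le> real_of_int (b - 4)"
      unfolding b_def using A B by (simp flip: lg_div)
    ultimately have "real c < real_of_int b + 2"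
      using c by auto
    \<comment> \<open>Integrality gives \<open>c \<le> b + 1\<close>, and the reused value of
      \<open>f\<close> saves one more evaluation; \<open>1 \<le> c\<close> keeps the natural
      subtraction exact.\<close>
    then have "int (c - 1) \<le> b"
      using * by linarith
    then have "int (N + (c - 1)) \<le> int (Suc (Suc j)) * b + E"
      using IH by (simp add: algebra_simps)
    then show ?case
      using * by blast
  qed
  from this[of "k - 1"] obtain x t N where
    "descent f \<beta> T0 x0 d k = Some (x, t, N)" "int N \<le> int k * b + E"
    using k by auto
  moreover have "B / A = gamma_max ty * (1 + w) / (gamma_min ty * (1 - w))"
    using m by (simp add: A_def B_def flip: w_def)
  moreover have "\<beta>\<^sup>2 * A / T0 = \<beta>\<^sup>2 * gamma_min ty * (1 - w) / (m * T0)"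
    by (simp add: A_def mult_ac flip: w_def)
  moreover have "T0 / (\<beta> * B) = m * T0 / (\<beta> * gamma_max ty * (1 + w))"
    by (simp add: B_def mult_ac flip: w_def)
  ultimately show ?thesis
    unfolding b_def E_def lg_def w_def by auto
qed

end
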